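(* Let $W, V \in L^{\infty}(\mathbb{R};\mathbb{R})$ and let $u$ be a real-valued solution to $$-u'' - (Wu)' + V u = 0 \quad \text{in } \mathbb{R}.$$ Assume that there exist $C, \varepsilon > 0$ such that $$\forall x \in \mathbb{R},\quad |u(x)| \leq C \exp(-|x|^{1+\varepsilon}).$$ Then $u \equiv 0$.
   Context: No sign condition is imposed on $V$. Since $W$ and $V$ are merely bounded and measurable, the equation is understood in the weak (distributional) sense, with $u$ in $H^1_{\mathrm{loc}}(\mathbb{R})$ (identified with its continuous representative). *)

theory Defs
  imports "HOL-Analysis.Analysis"
begin

definition Linfty :: "(real \<Rightarrow> real) \<Rightarrow> bool" where
  "Linfty f \<longleftrightarrow> f \<in> borel_measurable lebesgue \<and> (\<exists>K. AE x in lebesgue. \<bar>f x\<bar> \<le> K)"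

definition test_function :: "(real \<Rightarrow> real) \<Rightarrow> bool" where
  "test_function \<phi> \<longleftrightarrow>
     (\<forall>n x. (deriv ^^ n) \<phi> field_differentiable at x) \<and> compact (closure {x. \<phi> x \<noteq> 0})"

definition L2_loc :: "(real \<Rightarrow> real) \<Rightarrow> bool" where
  "L2_loc f \<longleftrightarrow> f \<in> borel_measurable lebesgue \<and>
     (\<forall>K. compact K \<longrightarrow> set_integrable lebesgue K (\<lambda>x. (f x)\<^sup>2))"

(* Only meaningful for locally integrable f and g, otherwise the Bochner integral
   may default to 0; below it is only used for functions satisfying L2_loc. *)
definition weak_derivative :: "(real \<Rightarrow> real) \<Rightarrow> (real \<Rightarrow> real) \<Rightarrow> bool" where
  "weak_derivative f g \<longleftrightarrow>
     (\<forall>\<phi>. test_function \<phi> \<longrightarrow>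
        (LINT x|lebesgue. f x * deriv \<phi> x) = - (LINT x|lebesgue. g x * \<phi> x))"

definition H1_loc :: "(real \<Rightarrow> real) \<Rightarrow> bool" where
  "H1_loc f \<longleftrightarrow> L2_loc f \<and> (\<exists>g. L2_loc g \<and> weak_derivative f g)"

(* Weak form of - u'' - (W u)' + V u = 0 on the real line: the equation is tested against
   phi, with one derivative moved onto phi in the first two terms. The function g is the
   weak derivative of u, which is unique up to null sets, so its choice is immaterial. *)
definition weak_solution ::
  "(real \<Rightarrow> real) \<Rightarrow> (real \<Rightarrow> real) \<Rightarrow> (real \<Rightarrow> real) \<Rightarrow> bool" where
  "weak_solution W V u \<longleftrightarrow> H1_loc u \<and>
     (\<exists>g. L2_loc g \<and> weak_derivative u g \<and>
        (\<forall>\<phi>. test_function \<phi> \<longrightarrow>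
           (LINT x|lebesgue. g x * deriv \<phi> x + W x * u x * deriv \<phi> x + V x * u x * \<phi> x) = 0))"

end

theory Submission
  imports Defs "HOL-Real_Asymp.Real_Asymp"
begin

text \<open>
  Integrating the equation twice from infinity, where \<open>u\<close> decays, gives formally
  \<open>u(x) = \<integral>\<^sub>x\<^sup>\<infinity> W u dt + \<integral>\<^sub>x\<^sup>\<infinity> (t - x) V u dt\<close>. This is the weak equation tested with the ramp
  \<open>max 0 (t - x)\<close>, whose second derivative is the Dirac mass at \<open>x\<close>; rigorously one tests with
  smoothed and truncated ramps. If \<open>\<bar>W\<bar>, \<bar>V\<bar> \<le> K\<close> and \<open>\<bar>u(t)\<bar> \<le> M exp(- \<kappa> t)\<close> for all
  \<open>t\<close>, the identity yields \<open>\<bar>u(x)\<bar> \<le> K (1/\<kappa> + 1/\<kappa>\<^sup>2) M exp(- \<kappa> x)\<close>. The superexponential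
  decay allows \<open>\<kappa>\<close> large, so that the constant \<open>M\<close> can be halved again and again.
\<close>

section \<open>Smooth functions\<close>

text \<open>The smoothness half of \<open>test_function\<close>, kept apart from compact support
  because steps and ramps lack the latter.\<close>

definition smooth :: "(real \<Rightarrow> real) \<Rightarrow> bool" where
  "smooth f \<longleftrightarrow> (\<forall>n x. (deriv ^^ n) f field_differentiable at x)"

text \<open>By induction every iterated derivative of \<open>f\<close> stays in \<open>P\<close>, so
  a class of differentiable functions closed under \<open>deriv\<close> replaces formulas for higher
  derivatives.\<close>

lemma smooth_coinduct:
  assumes "P f" and step: "\<And>h. P h \<Longrightarrow> (\<forall>x. h field_differentiable at x) \<and> P (deriv h)"
  shows "smooth f"
proof -
  have "P ((deriv ^^ n) f)" for n
    by (induction n) (use assms in auto)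
  then show ?thesis
    unfolding smooth_def using step by blast
qed

lemma smooth_differentiable: "smooth f \<Longrightarrow> f field_differentiable at x"
  unfolding smooth_def by (metis funpow_0)

lemma smooth_deriv: "smooth f \<Longrightarrow> smooth (deriv f)"
  unfolding smooth_def by (metis funpow_Suc_right o_apply)

lemma smooth_has_deriv: "smooth f \<Longrightarrow> (f has_field_derivative deriv f x) (at x)"
  by (simp add: DERIV_deriv_iff_field_differentiable smooth_differentiable)

lemma smooth_continuous_on: "smooth f \<Longrightarrow> continuous_on S f"
  by (meson DERIV_isCont continuous_at_imp_continuous_on smooth_has_deriv)

lemma smooth_antiderivative:
  assumes "\<And>x. (f has_field_derivative f' x) (at x)" "smooth f'"
  shows "smooth f"
proof (rule smooth_coinduct[where P = "\<lambda>h. h = f \<or> smooth h"])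
  have "deriv f = f'"
    using assms(1) DERIV_imp_deriv by blast
  then show "(\<forall>x. h field_differentiable at x) \<and> (deriv h = f \<or> smooth (deriv h))"
    if "h = f \<or> smooth h" for h
    using that assms field_differentiable_def smooth_deriv smooth_differentiable by blast
qed simp

text \<open>Unlike single products, sums of products are closed under \<^const>\<open>deriv\<close>, as
  \<open>smooth_coinduct\<close> requires.\<close>

inductive sum_of_products :: "(real \<Rightarrow> real) \<Rightarrow> bool" where
  product: "smooth f \<Longrightarrow> smooth g \<Longrightarrow> sum_of_products (\<lambda>x. f x * g x)"
| sum: "sum_of_products f \<Longrightarrow> sum_of_products g \<Longrightarrow> sum_of_products (\<lambda>x. f x + g x)"

lemma smooth_mult:
  assumes "smooth f" "smooth g"
  shows "smooth (\<lambda>x. f x * g x)"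
proof (rule smooth_coinduct[where P = sum_of_products])
  show "sum_of_products (\<lambda>x. f x * g x)"
    using assms by (rule product)
next
  fix h assume "sum_of_products h"
  then show "(\<forall>x. h field_differentiable at x) \<and> sum_of_products (deriv h)"
  proof induction
    case (product f g)
    have D: "((\<lambda>x. f x * g x) has_field_derivative deriv f x * g x + f x * deriv g x) (at x)" for x
      using DERIV_mult[OF smooth_has_deriv[OF product(1)] smooth_has_deriv[OF product(2)], of x]
      by (simp add: algebra_simps)
    then have "deriv (\<lambda>x. f x * g x) = (\<lambda>x. deriv f x * g x + f x * deriv g x)"
      using DERIV_imp_deriv by blast
    moreover have "sum_of_products (\<lambda>x. deriv f x * g x + f x * deriv g x)"
      using product by (intro sum_of_products.intros smooth_deriv)
    ultimately show ?case
      using D field_differentiable_def by metis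
  next
    case (sum f g)
    then have "deriv (\<lambda>x. f x + g x) = (\<lambda>x. deriv f x + deriv g x)"
      by auto
    then show ?case
      using sum by (auto intro: field_differentiable_add sum_of_products.sum)
  qed
qed

text \<open>By the chain rule each derivative produces another factor \<open>a\<close>, so the
  constant \<open>c\<close> must vary within the invariant class.\<close>

lemma smooth_affine:
  assumes "smooth g"
  shows "smooth (\<lambda>x. c * g (a * x + b))"
proof (rule smooth_coinduct[where P = "\<lambda>h. \<exists>g c. smooth g \<and> h = (\<lambda>x. c * g (a * x + b))"])
  fix h assume "\<exists>g c. smooth g \<and> h = (\<lambda>x. c * g (a * x + b))"
  then obtain g c where g: "smooth g" and h: "h = (\<lambda>x. c * g (a * x + b))"
    by blast
  have "(h has_field_derivative c * a * deriv g (a * x + b)) (at x)" for x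
    unfolding h
    by (auto intro!: derivative_eq_intros DERIV_chain2[where f = g] smooth_has_deriv[OF g])
  moreover from this have "deriv h = (\<lambda>x. c * a * deriv g (a * x + b))"
    using DERIV_imp_deriv by blast
  ultimately show "(\<forall>x. h field_differentiable at x) \<and>
      (\<exists>g c. smooth g \<and> deriv h = (\<lambda>x. c * g (a * x + b)))"
    using smooth_deriv[OF g] field_differentiable_def by blast
qed (use assms in blast)

text \<open>The polynomial factor makes this family closed under \<^const>\<open>deriv\<close>.\<close>

definition flat :: "real poly \<Rightarrow> real \<Rightarrow> real" where
  "flat p x = (if x > 0 then poly p (1 / x) * exp (- (1 / x)) else 0)"

text \<open>Substituting \<open>y = 1 / x\<close> turns the right-hand limit into exponential decay
  beating every power of \<open>y\<close>; left of 0 the function vanishes.\<close>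

lemma flat_tendsto_0: "(flat p \<longlongrightarrow> 0) (at 0)"
proof -
  have "((\<lambda>y. \<Sum>i\<le>degree p. coeff p i * (y ^ i / exp y)) \<longlongrightarrow> (\<Sum>i\<le>degree p. coeff p i * 0)) at_top"
    by (intro tendsto_intros tendsto_power_div_exp_0)
  then have "((\<lambda>y. poly p y * exp (- y)) \<longlongrightarrow> 0) at_top"
    by (simp add: poly_altdef sum_divide_distrib exp_minus divide_inverse[symmetric])
  then have "((\<lambda>x. poly p (1 / x) * exp (- (1 / x))) \<longlongrightarrow> 0) (at_right 0)"
    by (simp add: filterlim_at_top_to_right inverse_eq_divide)
  moreover have "\<forall>\<^sub>F x in at_right 0. poly p (1 / x) * exp (- (1 / x)) = flat p x"
    by (auto simp: flat_def eventually_at_right_less intro: eventually_mono[OF eventually_at_right_less])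
  ultimately have "(flat p \<longlongrightarrow> 0) (at_right 0)"
    using tendsto_cong by force
  moreover have "\<forall>\<^sub>F x in at_left 0. flat p x = 0"
    by (rule eventually_mono[OF eventually_at_left_real[of "-1" 0]]) (auto simp: flat_def)
  then have "(flat p \<longlongrightarrow> 0) (at_left 0)"
    using tendsto_eventually by blast
  ultimately show ?thesis
    using filterlim_split_at by blast
qed

text \<open>For positive x the chain rule gives x^-2 (p - p')(1/x) exp(-1/x), and
  \<open>[:0, 0, 1:]\<close> is the polynomial X^2, evaluated at 1/x. The delicate point is 0, where
  the difference quotient is needed.\<close>

lemma flat_has_deriv:
  "(flat p has_field_derivative flat ([:0, 0, 1:] * (p - pderiv p)) x) (at x)"
proof (cases x "0 :: real" rule: linorder_cases)
  case less
  have "((\<lambda>_. 0) has_field_derivative flat ([:0, 0, 1:] * (p - pderiv p)) x) (at x)"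
    using less by (simp add: flat_def)
  then show ?thesis
    by (rule has_field_derivative_transform_within_open[of _ _ _ "{..<0}"])
      (use less in \<open>auto simp: flat_def\<close>)
next
  case equal
  \<comment> \<open>The polynomial is evaluated at 1/h, so dividing by h multiplies it by X: the
    difference quotient belongs to the same family and tends to 0.\<close>
  have "(\<lambda>h. (flat p (0 + h) - flat p 0) / h) = flat (pCons 0 p)"
    by (auto simp: flat_def fun_eq_iff)
  then show ?thesis
    using flat_tendsto_0[of "pCons 0 p"] equal
    by (simp add: DERIV_def) (simp add: flat_def)
next
  case greater
  have "((\<lambda>x. poly p (1 / x) * exp (- (1 / x))) has_field_derivative
      flat ([:0, 0, 1:] * (p - pderiv p)) x) (at x)"
    using greater
    by (auto intro!: derivative_eq_intros DERIV_chain2[where f = "poly p"] poly_DERIV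
        simp: flat_def field_simps power2_eq_square)
  then show ?thesis
    by (rule has_field_derivative_transform_within_open[of _ _ _ "{0<..}"])
      (use greater in \<open>auto simp: flat_def\<close>)
qed

lemma smooth_flat: "smooth (flat p)"
proof (rule smooth_coinduct[where P = "\<lambda>h. \<exists>p. h = flat p"])
  show "(\<forall>x. h field_differentiable at x) \<and> (\<exists>q. deriv h = flat q)" if "\<exists>p. h = flat p" for h
    using that flat_has_deriv DERIV_imp_deriv field_differentiable_def by blast
qed blast

section \<open>Bump, smooth step and smoothed ramp\<close>

lemma antiderivative_exists:
  fixes f :: "real \<Rightarrow> real"
  assumes "continuous_on UNIV f" and "\<And>x. x \<le> 0 \<Longrightarrow> f x = 0"
  shows "\<exists>F. (\<forall>x. (F has_field_derivative f x) (at x)) \<and> (\<forall>x\<le>0. F x = 0)"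
proof (intro exI conjI allI impI)
  let ?F = "\<lambda>x. integral {0..x} f"
  show Fz: "?F x = 0" if "x \<le> 0" for x
    using that by (cases "x = 0") auto
  fix x :: real
  \<comment> \<open>\<open>{0..x}\<close> is empty for negative \<open>x\<close>, so the fundamental
    theorem is applied with a base point left of both \<open>x\<close> and 0. As \<open>f\<close>
    vanishes up to 0, this leaves the integral unchanged.\<close>
  define a :: real where "a = min (x - 1) (-1)"
  have int: "f integrable_on {c..d}" for c d
    by (meson assms(1) continuous_on_subset integrable_continuous_real subset_UNIV)
  have eq: "integral {a..y} f = ?F y" if "a < y" for y :: real
  proof (cases "y \<le> 0")
    case True
    then have "integral {a..y} f = integral {a..y} (\<lambda>_. 0)"
      by (intro integral_cong) (use assms(2) in auto)
    then show ?thesis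
      using Fz[OF True] by simp
  next
    case False
    have "integral {a..0} f = integral {a..0} (\<lambda>_. 0)"
      by (intro integral_cong) (use assms(2) in auto)
    then show ?thesis
      using Henstock_Kurzweil_Integration.integral_combine[of a 0 y f] int False
      by (simp add: a_def)
  qed
  have "((\<lambda>y. integral {a..y} f) has_real_derivative f x) (at x within {a..x+1})"
    by (rule integral_has_real_derivative)
      (auto simp: a_def intro: continuous_on_subset[OF assms(1)])
  then have "((\<lambda>y. integral {a..y} f) has_real_derivative f x) (at x)"
    by (subst (asm) at_within_Icc_at) (auto simp: a_def)
  then show "(?F has_field_derivative f x) (at x)"
    by (rule has_field_derivative_transform_within_open[of _ _ _ "{a<..}"])
      (use eq in \<open>auto simp: a_def\<close>)
qed

text \<open>Integrating a normalised bump twice gives smooth versions of the Dirac mass, the unit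
  step and the ramp \<open>max 0 t\<close>. Such triples later supply both the approximate Dirac
  mass with its ramp and the cut-off.\<close>

lemma smooth_step_exists:
  obtains \<rho> \<theta> r :: "real \<Rightarrow> real"
  where "smooth \<rho>" "smooth \<theta>" "smooth r"
    and "\<And>t. (\<theta> has_field_derivative \<rho> t) (at t)" "\<And>t. (r has_field_derivative \<theta> t) (at t)"
    and "\<And>t. 0 \<le> \<rho> t" "\<And>t. t \<notin> {0..1} \<Longrightarrow> \<rho> t = 0"
    and "\<And>t. t \<le> 0 \<Longrightarrow> \<theta> t = 0" "\<And>t. 1 \<le> t \<Longrightarrow> \<theta> t = 1" "\<And>t. 0 \<le> \<theta> t" "\<And>t. \<theta> t \<le> 1"
    and "\<And>t. 0 \<le> r t" "\<And>t. r t \<le> max 0 t"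
proof -
  \<comment> \<open>\<open>flat 1 t\<close> is exp(-1/t) for t > 0 and 0 otherwise, so multiplying
    it by its mirror image confines the support to [0, 1].\<close>
  define b where "b t = flat 1 t * flat 1 (1 - t)" for t
  have "smooth b"
    using smooth_mult[OF smooth_flat[of 1] smooth_affine[OF smooth_flat[of 1], of 1 "-1" 1]]
    by (simp add: b_def[abs_def])
  have b0: "b t = 0" if "t \<le> 0 \<or> 1 \<le> t" for t
    using that by (auto simp: b_def flat_def)
  have b_pos: "b t > 0" if "0 < t" "t < 1" for t
    using that by (auto simp: b_def flat_def)
  have b_nonneg: "b t \<ge> 0" for t
    by (simp add: b_def flat_def)
  obtain B where B: "\<And>x. (B has_field_derivative b x) (at x)" and B0: "\<And>x. x \<le> 0 \<Longrightarrow> B x = 0"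
    using antiderivative_exists[of b] smooth_continuous_on[OF \<open>smooth b\<close>] b0 by auto
  \<comment> \<open>Strict growth makes the total mass \<open>B 1\<close> positive, so that the bump
    can be divided by it.\<close>
  have "B 0 < B 1"
  proof (rule DERIV_pos_imp_increasing_open[of 0 1 B])
    show "continuous_on {0..1} B"
      using B by (meson DERIV_isCont continuous_at_imp_continuous_on)
  qed (use B b_pos in \<open>auto intro!: exI\<close>)
  then have c: "B 1 > 0"
    using B0 by simp
  define \<rho> where "\<rho> t = b t / B 1" for t
  define \<theta> where "\<theta> t = B t / B 1" for t
  have \<rho>: "smooth \<rho>"
    using smooth_affine[OF \<open>smooth b\<close>, of "1 / B 1" 1 0] by (simp add: \<rho>_def[abs_def])
  have \<theta>_der: "(\<theta> has_field_derivative \<rho> t) (at t)" for t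
    unfolding \<theta>_def[abs_def] \<rho>_def using B c by (auto intro!: derivative_eq_intros)
  then have \<theta>: "smooth \<theta>"
    using \<rho> by (rule smooth_antiderivative)
  have \<rho>_nonneg: "0 \<le> \<rho> t" for t
    using b_nonneg c by (simp add: \<rho>_def)
  have \<theta>_mono: "\<theta> s \<le> \<theta> t" if "s \<le> t" for s t
    by (rule DERIV_nonneg_imp_nondecreasing[OF that]) (use \<theta>_der \<rho>_nonneg in blast)
  have \<theta>_0: "\<theta> t = 0" if "t \<le> 0" for t
    using that B0 by (simp add: \<theta>_def)
  have \<theta>_1: "\<theta> t = 1" if t: "1 \<le> t" for t
  proof (cases "t = 1")
    case False
    then obtain z where "1 < z" "\<theta> t - \<theta> 1 = (t - 1) * \<rho> z"
      using MVT2[of 1 t \<theta> \<rho>] \<theta>_der t by auto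
    then show ?thesis
      using b0[of z] c by (simp add: \<rho>_def \<theta>_def)
  qed (use c in \<open>simp add: \<theta>_def\<close>)
  have \<theta>_nonneg: "0 \<le> \<theta> t" for t
    using \<theta>_mono[of "min 0 t" t] \<theta>_0[of "min 0 t"] by simp
  have \<theta>_le: "\<theta> t \<le> 1" for t
    using \<theta>_mono[of t "max 1 t"] \<theta>_1[of "max 1 t"] by simp
  obtain r where r: "\<And>x. (r has_field_derivative \<theta> x) (at x)" and r0: "\<And>x. x \<le> 0 \<Longrightarrow> r x = 0"
    using antiderivative_exists[of \<theta>] smooth_continuous_on[OF \<theta>] \<theta>_0 by auto
  have "0 \<le> r t \<and> r t \<le> max 0 t" for t
  proof (cases "t \<le> 0")
    case False
    \<comment> \<open>The mean slope of \<open>r\<close> over [0, t] is a value of \<theta>, hence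
      lies in [0, 1]; both bounds on \<open>r\<close> follow.\<close>
    then obtain z where "r t - r 0 = (t - 0) * \<theta> z"
      using MVT2[of 0 t r \<theta>] r by auto
    then show ?thesis
      using r0[of 0] False \<theta>_nonneg[of z] \<theta>_le[of z] by (simp add: mult_left_le)
  qed (use r0 in simp)
  then show thesis
    by (intro that[of \<rho> \<theta> r] \<rho> \<theta> r smooth_antiderivative[OF r \<theta>] \<theta>_der \<rho>_nonneg
        \<theta>_0 \<theta>_1 \<theta>_nonneg \<theta>_le) (auto simp: \<rho>_def b0)
qed

text \<open>A dilation squeezes the transition into an interval of length \<delta>, so that \<rho>
  concentrates at \<open>x\<close> as \<delta> shrinks.\<close>

lemma scaled_step_exists:
  fixes x \<delta> :: real
  assumes "\<delta> > 0"
  obtains \<rho> \<theta> r :: "real \<Rightarrow> real"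
  where "smooth \<rho>" "smooth \<theta>" "smooth r"
    and "\<And>t. (\<theta> has_field_derivative \<rho> t) (at t)" "\<And>t. (r has_field_derivative \<theta> t) (at t)"
    and "\<And>t. 0 \<le> \<rho> t" "\<And>t. t \<notin> {x..x + \<delta>} \<Longrightarrow> \<rho> t = 0"
    and "\<And>t. t \<le> x \<Longrightarrow> \<theta> t = 0" "\<And>t. x + \<delta> \<le> t \<Longrightarrow> \<theta> t = 1" "\<And>t. 0 \<le> \<theta> t" "\<And>t. \<theta> t \<le> 1"
    and "\<And>t. 0 \<le> r t" "\<And>t. r t \<le> max 0 (t - x)"
proof -
  obtain \<rho> \<theta> r :: "real \<Rightarrow> real"
    where sm: "smooth \<rho>" "smooth \<theta>" "smooth r"
    and der: "\<And>t. (\<theta> has_field_derivative \<rho> t) (at t)" "\<And>t. (r has_field_derivative \<theta> t) (at t)"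
    and \<rho>: "\<And>t. 0 \<le> \<rho> t" "\<And>t. t \<notin> {0..1} \<Longrightarrow> \<rho> t = 0"
    and \<theta>: "\<And>t. t \<le> 0 \<Longrightarrow> \<theta> t = 0" "\<And>t. 1 \<le> t \<Longrightarrow> \<theta> t = 1" "\<And>t. 0 \<le> \<theta> t" "\<And>t. \<theta> t \<le> 1"
    and r: "\<And>t. 0 \<le> r t" "\<And>t. r t \<le> max 0 t"
    using smooth_step_exists by blast
  define s where "s t = (t - x) / \<delta>" for t
  have s_affine: "s t = (1 / \<delta>) * t + (- x / \<delta>)" for t
    by (simp add: s_def diff_divide_distrib)
  have s_der: "(s has_field_derivative 1 / \<delta>) (at t)" for t
    unfolding s_def[abs_def] using assms by (auto intro!: derivative_eq_intros)
  have s_le: "s t \<le> 0 \<longleftrightarrow> t \<le> x" "1 \<le> s t \<longleftrightarrow> x + \<delta> \<le> t" "s t \<in> {0..1} \<longleftrightarrow> t \<in> {x..x + \<delta>}" for t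
    using assms by (auto simp: s_def field_simps)
  show thesis
  \<comment> \<open>The outer factors \<open>1 / \<delta>\<close> and \<open>\<delta>\<close>
    compensate the chain rule, so each function remains the derivative of the next.\<close>
  proof (rule that[of "\<lambda>t. (1 / \<delta>) * \<rho> (s t)" "\<lambda>t. \<theta> (s t)" "\<lambda>t. \<delta> * r (s t)"])
    show "smooth (\<lambda>t. (1 / \<delta>) * \<rho> (s t))" "smooth (\<lambda>t. \<theta> (s t))" "smooth (\<lambda>t. \<delta> * r (s t))"
      using smooth_affine[OF sm(1), of "1 / \<delta>" "1 / \<delta>" "- x / \<delta>"]
        smooth_affine[OF sm(2), of 1 "1 / \<delta>" "- x / \<delta>"]
        smooth_affine[OF sm(3), of \<delta> "1 / \<delta>" "- x / \<delta>"]
      unfolding s_affine by simp_all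
    show "((\<lambda>t. \<theta> (s t)) has_field_derivative (1 / \<delta>) * \<rho> (s t)) (at t)" for t
      using DERIV_chain2[OF der(1) s_der, of t] by (simp add: mult.commute)
    show "((\<lambda>t. \<delta> * r (s t)) has_field_derivative \<theta> (s t)) (at t)" for t
      using DERIV_cmult[OF DERIV_chain2[OF der(2) s_der, of t], of \<delta>] assms by simp
    show "\<delta> * r (s t) \<le> max 0 (t - x)" for t
      using mult_left_mono[OF r(2)[of "s t"], of \<delta>] assms
      by (simp add: s_def max_mult_distrib_left)
  qed (use assms \<rho> \<theta> r s_le in \<open>auto simp del: atLeastAtMost_iff\<close>)
qed

section \<open>Weak solutions tested against smooth functions\<close>

lemma deriv_zero_outside:
  fixes \<phi> :: "real \<Rightarrow> real"
  assumes "\<And>t. t \<notin> {a..b} \<Longrightarrow> \<phi> t = 0" "t \<notin> {a..b}"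
  shows "deriv \<phi> t = 0"
proof -
  have "(\<phi> has_field_derivative 0) (at t)"
    by (rule has_field_derivative_transform_within_open[of "\<lambda>_. 0" _ _ "- {a..b}"])
      (use assms in auto)
  then show ?thesis
    by (rule DERIV_imp_deriv)
qed

section \<open>Bounds and integrability under compact support\<close>

lemma compact_support_bounded:
  fixes f :: "real \<Rightarrow> real"
  assumes "continuous_on UNIV f" "\<And>t. t \<notin> {a..b} \<Longrightarrow> f t = 0"
  obtains B where "\<And>t. \<bar>f t\<bar> \<le> B"
proof -
  have "bounded (f ` {a..b})"
    by (intro compact_imp_bounded compact_continuous_image continuous_on_subset[OF assms(1)]) auto
  then obtain B where B: "\<And>t. t \<in> {a..b} \<Longrightarrow> \<bar>f t\<bar> \<le> B"
    unfolding bounded_real by blast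
  \<comment> \<open>The interval may be empty, and then \<open>B\<close> may be negative.\<close>
  have "\<bar>f t\<bar> \<le> max 0 B" for t
  proof (cases "t \<in> {a..b}")
    case True
    then show ?thesis
      using B[of t] by simp
  qed (use assms(2)[of t] in simp)
  then show thesis
    using that by blast
qed

lemma continuous_borel_measurable_lebesgue:
  "continuous_on UNIV f \<Longrightarrow> (f :: real \<Rightarrow> real) \<in> borel_measurable lebesgue"
  by (simp add: measurable_completion borel_measurable_continuous_onI)

lemma integrable_compact_support:
  fixes f :: "real \<Rightarrow> real"
  assumes "continuous_on UNIV f" "\<And>t. t \<notin> {a..b} \<Longrightarrow> f t = 0"
  shows "integrable lebesgue f"
proof -
  have "integrable lborel (\<lambda>x. indicator {a..b} x *\<^sub>R f x)"
    by (intro borel_integrable_compact continuous_on_subset[OF assms(1)]) auto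
  also have "(\<lambda>x. indicator {a..b} x *\<^sub>R f x) = f"
    using assms(2) by (force simp: indicator_def)
  finally show ?thesis
    using assms(1) by (subst integrable_completion) (auto intro: borel_measurable_continuous_onI)
qed

lemma integrable_Linfty_mult:
  assumes "Linfty W" "continuous_on UNIV f" "\<And>t. t \<notin> {a..b} \<Longrightarrow> f t = 0"
  shows "integrable lebesgue (\<lambda>t. W t * f t)"
proof -
  obtain K where K: "AE t in lebesgue. \<bar>W t\<bar> \<le> K"
    using assms(1) by (auto simp: Linfty_def)
  show ?thesis
  proof (rule Bochner_Integration.integrable_bound)
    show "integrable lebesgue (\<lambda>t. K * f t)"
      using integrable_compact_support[OF assms(2,3)] by simp
    show "(\<lambda>t. W t * f t) \<in> borel_measurable lebesgue"
      using assms continuous_borel_measurable_lebesgue by (auto simp: Linfty_def)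
    show "AE t in lebesgue. norm (W t * f t) \<le> norm (K * f t)"
      using K by eventually_elim (auto simp: abs_mult intro: mult_right_mono)
  qed
qed

text \<open>Bounding the absolute value of \<open>g t\<close> by \<open>1 + (g t)\<^sup>2\<close>,
  which is integrable over \<open>{a..b}\<close>, takes the place of the Cauchy-Schwarz
  inequality.\<close>

lemma integrable_L2_loc_mult:
  assumes "L2_loc g" "continuous_on UNIV f" "\<And>t. t \<notin> {a..b} \<Longrightarrow> f t = 0"
  shows "integrable lebesgue (\<lambda>t. g t * f t)"
proof -
  obtain B where B: "\<And>t. \<bar>f t\<bar> \<le> B"
    using compact_support_bounded[OF assms(2,3)] by metis
  have sq: "set_integrable lebesgue {a..b} (\<lambda>t. 1 + (g t)\<^sup>2)"
    using assms(1) by (auto simp: L2_loc_def integrable_completion intro!: set_integral_add(1))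
  show ?thesis
  proof (rule Bochner_Integration.integrable_bound)
    show "integrable lebesgue (\<lambda>t. B * (indicator {a..b} t *\<^sub>R (1 + (g t)\<^sup>2)))"
      using sq by (simp add: set_integrable_def)
    show "(\<lambda>t. g t * f t) \<in> borel_measurable lebesgue"
      using assms continuous_borel_measurable_lebesgue by (auto simp: L2_loc_def)
    have "\<bar>g t * f t\<bar> \<le> \<bar>B * (indicator {a..b} t *\<^sub>R (1 + (g t)\<^sup>2))\<bar>" for t
    proof (cases "t \<in> {a..b}")
      case True
      have "\<bar>g t\<bar> \<le> 1 + (g t)\<^sup>2"
        using zero_le_power2[of "\<bar>g t\<bar> - 1"] by (simp add: power2_eq_square algebra_simps)
      then have "\<bar>g t\<bar> * \<bar>f t\<bar> \<le> (1 + (g t)\<^sup>2) * B"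
        using B[of t] by (intro mult_mono) auto
      then show ?thesis
        using True abs_ge_self[of "B * (1 + (g t)\<^sup>2)"]
        by (simp add: abs_mult mult.commute)
    qed (use assms(3)[of t] in auto)
    then show "AE t in lebesgue. norm (g t * f t) \<le> norm (B * (indicator {a..b} t *\<^sub>R (1 + (g t)\<^sup>2)))"
      by simp
  qed
qed

section \<open>Moving both derivatives onto the test function\<close>

lemma test_functionI:
  assumes "smooth \<phi>" "\<And>t. t \<notin> {a..b} \<Longrightarrow> \<phi> t = 0"
  shows "test_function \<phi>"
proof -
  have "{t. \<phi> t \<noteq> 0} \<subseteq> {a..b}"
    using assms(2) by blast
  then show ?thesis
    using assms(1) bounded_subset[OF bounded_closed_interval]
    by (auto simp: test_function_def smooth_def)
qed

text \<open>\<open>deriv \<phi>\<close> is itself a test function, so the definition of the weak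
  derivative applies to it and eliminates \<open>g\<close>. From here on, estimates involve only the
  size of \<open>u\<close>, never that of its derivative.\<close>

lemma weak_solution_very_weak:
  assumes "Linfty W" "Linfty V" "continuous_on UNIV u" "weak_solution W V u"
    and "smooth \<phi>" "\<And>t. t \<notin> {a..b} \<Longrightarrow> \<phi> t = 0"
  shows "(LINT t|lebesgue. u t * deriv (deriv \<phi>) t) =
    (LINT t|lebesgue. W t * (u t * deriv \<phi> t) + V t * (u t * \<phi> t))"
proof -
  obtain g where g: "L2_loc g" "weak_derivative u g"
    and eq: "\<And>\<phi>. test_function \<phi> \<Longrightarrow>
      (LINT t|lebesgue. g t * deriv \<phi> t + W t * u t * deriv \<phi> t + V t * u t * \<phi> t) = 0"
    using assms(4) by (auto simp: weak_solution_def)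
  note sm = assms(5) smooth_deriv[OF assms(5)]
  have d0: "deriv \<phi> t = 0" if "t \<notin> {a..b}" for t
    using deriv_zero_outside[of a b \<phi>, OF assms(6)] that by blast
  have g_int: "integrable lebesgue (\<lambda>t. g t * deriv \<phi> t)"
    using integrable_L2_loc_mult[OF g(1) smooth_continuous_on[OF sm(2)]] d0 by blast
  have W_int: "integrable lebesgue (\<lambda>t. W t * (u t * deriv \<phi> t))"
    by (rule integrable_Linfty_mult[OF assms(1)
        continuous_on_mult[OF assms(3) smooth_continuous_on[OF sm(2)]], of a b])
      (simp add: d0)
  have V_int: "integrable lebesgue (\<lambda>t. V t * (u t * \<phi> t))"
    by (rule integrable_Linfty_mult[OF assms(2)
        continuous_on_mult[OF assms(3) smooth_continuous_on[OF sm(1)]], of a b])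
      (simp add: assms(6))
  have "(LINT t|lebesgue. u t * deriv (deriv \<phi>) t) = - (LINT t|lebesgue. g t * deriv \<phi> t)"
    using g(2) test_functionI[OF sm(2) d0] by (simp add: weak_derivative_def)
  moreover have "0 = (LINT t|lebesgue. g t * deriv \<phi> t + (W t * (u t * deriv \<phi> t) + V t * (u t * \<phi> t)))"
    using eq[OF test_functionI[of \<phi> a b, OF assms(5,6)]] by (simp add: algebra_simps)
  \<comment> \<open>Integrability of the three summands is what permits splitting the
    integral.\<close>
  ultimately show ?thesis
    using g_int W_int V_int by simp
qed

text \<open>The weight \<open>1 + t - x\<close> is the sum of the slope 1 and the height of the
  ramp, as the \<open>W\<close> and \<open>V\<close> terms demand. Taking \<open>s = x\<close> gives
  the main term of the decay estimate, \<open>s = N\<close> the cut-off error.\<close>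

lemma affine_exp_integral:
  fixes \<kappa> s x :: real
  assumes "\<kappa> > 0" "x \<le> s"
  shows "has_bochner_integral lebesgue (\<lambda>t. indicator {s..} t * ((1 + t - x) * exp (- (\<kappa> * t))))
    (exp (- (\<kappa> * s)) * ((1 + s - x) / \<kappa> + 1 / \<kappa>\<^sup>2))"
proof -
  \<comment> \<open>This antiderivative vanishes at infinity, so the integral over
    \<open>{s..}\<close> is \<open>- ?F s\<close>.\<close>
  let ?F = "\<lambda>t. - (exp (- (\<kappa> * t)) * ((1 + t - x) / \<kappa> + 1 / \<kappa>\<^sup>2))"
  let ?f = "\<lambda>t. indicator {s..} t * ((1 + t - x) * exp (- (\<kappa> * t)))"
  have "(?F \<longlongrightarrow> 0) at_top"
    using assms(1) by real_asymp
  moreover have "DERIV ?F t :> (1 + t - x) * exp (- (\<kappa> * t))" for t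
    using assms(1) by (auto intro!: derivative_eq_intros simp: field_simps power2_eq_square)
  ultimately have "(\<integral>\<^sup>+t. ennreal ((1 + t - x) * exp (- (\<kappa> * t))) * indicator {s..} t \<partial>lborel) = 0 - ?F s"
    using assms by (intro nn_integral_FTC_atLeast) auto
  also have "(\<integral>\<^sup>+t. ennreal ((1 + t - x) * exp (- (\<kappa> * t))) * indicator {s..} t \<partial>lborel) =
      (\<integral>\<^sup>+t. ennreal (?f t) \<partial>lborel)"
    by (intro nn_integral_cong) (auto simp: indicator_def)
  finally have "has_bochner_integral lborel ?f (exp (- (\<kappa> * s)) * ((1 + s - x) / \<kappa> + 1 / \<kappa>\<^sup>2))"
    using assms by (intro has_bochner_integral_nn_integral) (auto simp: indicator_def)
  then show ?thesis
    by (simp add: has_bochner_integral_iff integrable_completion integral_completion)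
qed

section \<open>Iterating the decay estimate\<close>

lemma integral_step_derivative:
  fixes \<theta> \<rho> :: "real \<Rightarrow> real"
  assumes der: "\<And>t. (\<theta> has_field_derivative \<rho> t) (at t)" and cont: "continuous_on UNIV \<rho>"
    and "a \<le> b" and supp: "\<And>t. t \<notin> {a..b} \<Longrightarrow> \<rho> t = 0"
  shows "(LINT t|lebesgue. \<rho> t) = \<theta> b - \<theta> a"
proof -
  have "(LINT t|lborel. indicator {a..b} t *\<^sub>R \<rho> t) = \<theta> b - \<theta> a"
    using \<open>a \<le> b\<close> der cont
    by (intro integral_FTC_atLeastAtMost)
      (auto simp: has_real_derivative_iff_has_vector_derivative[symmetric]
        intro: has_field_derivative_at_within continuous_on_subset)
  also have "(\<lambda>t. indicator {a..b} t *\<^sub>R \<rho> t) = \<rho>"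
  proof
    fix t show "indicator {a..b} t *\<^sub>R \<rho> t = \<rho> t"
      using supp[of t] by (auto simp: indicator_def)
  qed
  finally show ?thesis
    using cont by (simp add: integral_completion borel_measurable_continuous_onI)
qed

text \<open>As \<rho> has mass 1, the difference is the integral of
  \<open>(u t - c) * \<rho> t\<close>. With an approximate Dirac mass for \<rho> this recovers point
  values of \<open>u\<close>.\<close>

lemma average_close_to_value:
  fixes u \<rho> :: "real \<Rightarrow> real"
  assumes u: "continuous_on UNIV u" and \<rho>: "continuous_on UNIV \<rho>" "\<And>t. 0 \<le> \<rho> t"
    and supp: "\<And>t. t \<notin> {a..b} \<Longrightarrow> \<rho> t = 0" and total: "(LINT t|lebesgue. \<rho> t) = 1"
    and close: "\<And>t. t \<in> {a..b} \<Longrightarrow> \<bar>u t - c\<bar> \<le> \<eta>"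
  shows "\<bar>(LINT t|lebesgue. u t * \<rho> t) - c\<bar> \<le> \<eta>"
proof -
  have int_\<rho>: "integrable lebesgue \<rho>"
    using integrable_compact_support[OF \<rho>(1) supp] by blast
  have int_u\<rho>: "integrable lebesgue (\<lambda>t. u t * \<rho> t)"
    by (rule integrable_compact_support[OF continuous_on_mult[OF u \<rho>(1)], of a b]) (simp add: supp)
  have "(LINT t|lebesgue. u t * \<rho> t) - c = (LINT t|lebesgue. u t * \<rho> t - c * \<rho> t)"
    using int_\<rho> int_u\<rho> total by simp
  also have "\<bar>\<dots>\<bar> \<le> (LINT t|lebesgue. \<bar>u t * \<rho> t - c * \<rho> t\<bar>)"
    by (rule integral_abs_bound)
  also have "\<dots> \<le> (LINT t|lebesgue. \<eta> * \<rho> t)"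
  proof (rule integral_mono)
    show "\<bar>u t * \<rho> t - c * \<rho> t\<bar> \<le> \<eta> * \<rho> t" for t
    proof (cases "t \<in> {a..b}")
      case True
      then show ?thesis
        using mult_right_mono[OF close \<rho>(2)] \<rho>(2)[of t]
        by (simp add: left_diff_distrib[symmetric] abs_mult)
    qed (simp add: supp)
  qed (use int_\<rho> int_u\<rho> in auto)
  also have "\<dots> = \<eta>"
    using int_\<rho> total by simp
  finally show ?thesis .
qed

text \<open>Testing with the cut-off ramp \<open>r \<psi>\<close>, whose second derivative is \<open>\<sigma>\<close>, an
  approximation of the Dirac mass at \<open>x\<close>, up to terms supported in \<open>[N, N + 1]\<close>. The
  second summand of the bound comes from these cut-off terms and vanishes as \<open>N\<close> grows.\<close>

lemma ramp_test_estimate: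
  fixes W V u \<sigma> \<theta> r \<psi> :: "real \<Rightarrow> real"
  assumes "Linfty W" "Linfty V" and u: "continuous_on UNIV u" and "weak_solution W V u"
    and W: "AE t in lebesgue. \<bar>W t\<bar> \<le> K" and V: "AE t in lebesgue. \<bar>V t\<bar> \<le> K"
    and \<kappa>: "\<kappa> > 0" and decay: "\<And>t. \<bar>u t\<bar> \<le> M * exp (- (\<kappa> * t))"
    and sm: "smooth \<sigma>" "smooth \<theta>" "smooth r"
    and der: "\<And>t. (\<theta> has_field_derivative \<sigma> t) (at t)" "\<And>t. (r has_field_derivative \<theta> t) (at t)"
    and \<sigma>: "\<And>t. t \<notin> {x..y} \<Longrightarrow> \<sigma> t = 0"
    and \<theta>: "\<And>t. t \<le> x \<Longrightarrow> \<theta> t = 0" "\<And>t. 0 \<le> \<theta> t" "\<And>t. \<theta> t \<le> 1"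
    and r: "\<And>t. 0 \<le> r t" "\<And>t. r t \<le> max 0 (t - x)"
    and "smooth \<psi>" and \<psi>: "\<And>t. 0 \<le> \<psi> t" "\<And>t. \<psi> t \<le> 1" "\<And>t. t \<le> N \<Longrightarrow> \<psi> t = 1"
      "\<And>t. N + 1 \<le> t \<Longrightarrow> \<psi> t = 0"
    and P: "\<And>t. \<bar>deriv \<psi> t\<bar> \<le> P" "\<And>t. \<bar>deriv (deriv \<psi>) t\<bar> \<le> P"
    and "x \<le> N" "y \<le> N"
  shows "\<bar>LINT t|lebesgue. u t * \<sigma> t\<bar> \<le> K * M * (exp (- (\<kappa> * x)) * (1 / \<kappa> + 1 / \<kappa>\<^sup>2)) +
    (K + 2) * P * M * (exp (- (\<kappa> * N)) * ((1 + N - x) / \<kappa> + 1 / \<kappa>\<^sup>2))"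
proof -
  define \<phi> where "\<phi> t = r t * \<psi> t" for t
  define \<psi>1 where "\<psi>1 = deriv \<psi>"
  define \<psi>2 where "\<psi>2 = deriv \<psi>1"
  have sm\<psi>: "smooth \<psi>1" "smooth \<psi>2"
    using \<open>smooth \<psi>\<close> by (simp_all add: \<psi>1_def \<psi>2_def smooth_deriv)
  note cont = u smooth_continuous_on[OF sm(1)] smooth_continuous_on[OF sm(2)]
    smooth_continuous_on[OF sm(3)] smooth_continuous_on[OF \<open>smooth \<psi>\<close>]
    smooth_continuous_on[OF sm\<psi>(1)] smooth_continuous_on[OF sm\<psi>(2)]
  have \<psi>_der: "(\<psi> has_field_derivative \<psi>1 t) (at t)" "(\<psi>1 has_field_derivative \<psi>2 t) (at t)" for t
    using smooth_has_deriv \<open>smooth \<psi>\<close> sm\<psi> by (simp_all add: \<psi>1_def \<psi>2_def)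
  have r0: "r t = 0" if "t \<le> x" for t
    using r[of t] that by simp
  have \<psi>1_0: "\<psi>1 t = 0" if "t \<notin> {N..N+1}" for t
  proof -
    have "(\<psi> has_field_derivative 0) (at t)"
    proof (cases "t < N")
      case True
      show ?thesis
        by (rule has_field_derivative_transform_within_open[of "\<lambda>_. 1" _ _ "{..<N}"])
          (use True \<psi>(3) in auto)
    next
      case False
      with that have t: "t \<in> {N+1<..}"
        by auto
      show ?thesis
        by (rule has_field_derivative_transform_within_open[of "\<lambda>_. 0" _ _ "{N+1<..}"])
          (use t \<psi>(4) in auto)
    qed
    then show ?thesis
      unfolding \<psi>1_def by (rule DERIV_imp_deriv)
  qed
  have \<psi>2_0: "\<psi>2 t = 0" if "t \<notin> {N..N+1}" for t
    unfolding \<psi>2_def using deriv_zero_outside[of N "N+1" \<psi>1, OF \<psi>1_0] that by blast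
  have d1: "deriv \<phi> = (\<lambda>t. \<theta> t * \<psi> t + r t * \<psi>1 t)"
    unfolding \<phi>_def[abs_def]
    by (intro ext DERIV_imp_deriv) (auto intro!: derivative_eq_intros der \<psi>_der)
  have d2: "deriv (deriv \<phi>) = (\<lambda>t. \<sigma> t * \<psi> t + 2 * \<theta> t * \<psi>1 t + r t * \<psi>2 t)"
    unfolding d1 by (intro ext DERIV_imp_deriv) (auto intro!: derivative_eq_intros der \<psi>_der)
  \<comment> \<open>Since \<open>y \<le> N\<close>, the cut-off equals 1 on the support of \<sigma>
    and leaves the main term untouched.\<close>
  have \<sigma>\<psi>: "\<sigma> t * \<psi> t = \<sigma> t" for t
    using \<sigma>[of t] \<psi>(3)[of t] \<open>y \<le> N\<close> by (cases "t \<in> {x..y}") auto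
  have supp: "t \<notin> {x..N+1} \<Longrightarrow> \<phi> t = 0" for t
    using r0[of t] \<psi>(4)[of t] by (auto simp: \<phi>_def not_le)
  have "smooth \<phi>"
    unfolding \<phi>_def[abs_def] using sm(3) \<open>smooth \<psi>\<close> by (rule smooth_mult)
  note weak = weak_solution_very_weak[OF assms(1,2) u assms(4) \<open>smooth \<phi>\<close> supp]
  \<comment> \<open>\<open>E\<close> collects the terms of
    \<open>u t * deriv (deriv \<phi>) t\<close> in which a derivative falls on the cut-off;
    \<open>h\<close> is what remains when the weak equation is solved for the integral of
    \<open>u t * \<sigma> t\<close>.\<close>
  define E where "E t = u t * (2 * \<theta> t * \<psi>1 t + r t * \<psi>2 t)" for t
  define h where "h t = W t * (u t * deriv \<phi> t) + V t * (u t * \<phi> t) - E t" for t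
  have supp1: "deriv \<phi> t = 0" "deriv (deriv \<phi>) t = 0" if "t \<notin> {x..N+1}" for t
    using deriv_zero_outside[of x "N+1" \<phi>, OF supp]
      deriv_zero_outside[of x "N+1" "deriv \<phi>", OF deriv_zero_outside[of x "N+1" \<phi>, OF supp]] that
    by blast+
  have int_E: "integrable lebesgue E"
    unfolding E_def[abs_def]
    by (rule integrable_compact_support[of _ N "N+1"])
      (auto intro!: continuous_intros cont simp: \<psi>1_0 \<psi>2_0)
  have int_2: "integrable lebesgue (\<lambda>t. u t * deriv (deriv \<phi>) t)"
    using smooth_continuous_on[OF smooth_deriv[OF smooth_deriv[OF \<open>smooth \<phi>\<close>]]]
    by (intro integrable_compact_support[of _ x "N+1"] continuous_on_mult u) (simp_all add: supp1)
  have int_W: "integrable lebesgue (\<lambda>t. W t * (u t * deriv \<phi> t))"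
    using smooth_continuous_on[OF smooth_deriv[OF \<open>smooth \<phi>\<close>]]
    by (intro integrable_Linfty_mult[of W _ x "N+1"] continuous_on_mult u assms) (simp_all add: supp1)
  have int_V: "integrable lebesgue (\<lambda>t. V t * (u t * \<phi> t))"
    using smooth_continuous_on[OF \<open>smooth \<phi>\<close>]
    by (intro integrable_Linfty_mult[of V _ x "N+1"] continuous_on_mult u assms) (simp_all add: supp)
  have int_h: "integrable lebesgue h"
    unfolding h_def[abs_def] using int_W int_V int_E by simp
  have "u t * \<sigma> t = u t * deriv (deriv \<phi>) t - E t" for t
    unfolding d2 E_def \<sigma>\<psi> by (simp add: algebra_simps)
  then have "(LINT t|lebesgue. u t * \<sigma> t) = (LINT t|lebesgue. u t * deriv (deriv \<phi>) t - E t)"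
    by simp
  also have "\<dots> = (LINT t|lebesgue. h t)"
    unfolding h_def using int_2 int_E int_W int_V weak by simp
  finally have eq: "(LINT t|lebesgue. u t * \<sigma> t) = (LINT t|lebesgue. h t)" .

  \<comment> \<open>Two majorants of this form suffice: \<open>e x\<close> for the main term and
    \<open>e N\<close> for the terms containing derivatives of the cut-off.\<close>
  define e where "e s t = indicator {s..} t * ((1 + t - x) * exp (- (\<kappa> * t)))" for s t :: real
  have e: "has_bochner_integral lebesgue (e s)
      (exp (- (\<kappa> * s)) * ((1 + s - x) / \<kappa> + 1 / \<kappa>\<^sup>2))" if "x \<le> s" for s
    unfolding e_def using affine_exp_integral[OF \<kappa> that] .
  have "AE t in lebesgue. \<bar>h t\<bar> \<le> K * M * e x t + (K + 2) * P * M * e N t"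
    using W V
  proof eventually_elim
    case (elim t)
    have K: "K \<ge> 0" and P0: "P \<ge> 0"
      using elim P(1)[of t] by linarith+
    show ?case
    proof (cases "t < x")
      \<comment> \<open>Left of \<open>x\<close> both the ramp and its slope vanish, and with them
        \<open>h\<close>.\<close>
      case True
      then show ?thesis
        using \<open>x \<le> N\<close> by (simp add: h_def E_def d1 \<phi>_def e_def r0 \<theta>(1))
    next
      case False
      \<comment> \<open>\<open>q\<close> marks where the derivatives of the cut-off may be nonzero,
        so that one chain of estimates serves both sides of \<open>N\<close>. The mark extends to
        infinity to match the support of \<open>e N\<close>.\<close>
      define q where "q = (if N \<le> t then 1 else 0 :: real)"
      have rt: "r t \<le> t - x"
        using r(2)[of t] False by simp
      have q: "\<bar>\<psi>1 t\<bar> \<le> P * q" "\<bar>\<psi>2 t\<bar> \<le> P * q" "q \<ge> 0"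
        using \<psi>1_0[of t] \<psi>2_0[of t] P[of t] by (auto simp: q_def \<psi>1_def \<psi>2_def)
      have r\<psi>: "\<bar>r t * \<psi>1 t\<bar> \<le> (t - x) * (P * q)" "\<bar>r t * \<psi>2 t\<bar> \<le> (t - x) * (P * q)"
        unfolding abs_mult using q rt r(1)[of t] by (auto intro!: mult_mono)
      have \<theta>\<psi>: "\<bar>\<theta> t * \<psi> t\<bar> \<le> 1" "\<bar>\<theta> t * \<psi>1 t\<bar> \<le> P * q"
        using mult_mono[OF \<theta>(3)[of t] \<psi>(2)[of t]] mult_mono[OF \<theta>(3)[of t] q(1)] \<theta>(2)[of t] \<psi>(1)[of t]
        by (auto simp: abs_mult)
      have \<phi>: "\<bar>\<phi> t\<bar> \<le> t - x"
        using mult_mono[OF rt \<psi>(2)[of t]] r(1)[of t] \<psi>(1)[of t] False by (simp add: \<phi>_def abs_mult)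
      have \<phi>': "\<bar>deriv \<phi> t\<bar> \<le> 1 + (t - x) * (P * q)"
        unfolding d1 using r\<psi>(1) \<theta>\<psi>(1) by linarith
      have E: "\<bar>2 * \<theta> t * \<psi>1 t + r t * \<psi>2 t\<bar> \<le> 2 * (P * q) + (t - x) * (P * q)"
        using r\<psi>(2) \<theta>\<psi>(2) by linarith
      have "h t = u t * (W t * deriv \<phi> t + V t * \<phi> t - (2 * \<theta> t * \<psi>1 t + r t * \<psi>2 t))"
        by (simp add: h_def E_def algebra_simps)
      also have "\<bar>\<dots>\<bar> \<le> (M * exp (- (\<kappa> * t))) *
          (K * (1 + (t - x) * (P * q)) + K * (t - x) + (2 * (P * q) + (t - x) * (P * q)))"
      proof (unfold abs_mult, rule mult_mono[OF decay])
        have "\<bar>W t * deriv \<phi> t\<bar> \<le> K * (1 + (t - x) * (P * q))" "\<bar>V t * \<phi> t\<bar> \<le> K * (t - x)"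
          unfolding abs_mult using elim \<phi> \<phi>' K by (auto intro!: mult_mono)
        then show "\<bar>W t * deriv \<phi> t + V t * \<phi> t - (2 * \<theta> t * \<psi>1 t + r t * \<psi>2 t)\<bar> \<le>
            K * (1 + (t - x) * (P * q)) + K * (t - x) + (2 * (P * q) + (t - x) * (P * q))"
          using E by linarith
        show "0 \<le> M * exp (- (\<kappa> * t))"
          using decay[of t] by linarith
      qed simp
      \<comment> \<open>The terms carrying \<open>P * q\<close> have coefficient K + 1 at t - x and
        constant coefficient 2; the factor K + 2 covers both, and the slack is exactly the two
        nonnegative products below.\<close>
      also have "\<dots> \<le> (M * exp (- (\<kappa> * t))) * (K * (1 + t - x) + (K + 2) * (P * q) * (1 + t - x))"
      proof (rule mult_left_mono)
        have "0 \<le> K * (P * q)" "0 \<le> (t - x) * (P * q)"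
          using K P0 q(3) False by (auto intro!: mult_nonneg_nonneg)
        then show "K * (1 + (t - x) * (P * q)) + K * (t - x) + (2 * (P * q) + (t - x) * (P * q))
            \<le> K * (1 + t - x) + (K + 2) * (P * q) * (1 + t - x)"
          by (simp add: algebra_simps)
        show "0 \<le> M * exp (- (\<kappa> * t))"
          using decay[of t] by linarith
      qed
      also have "\<dots> = K * M * e x t + (K + 2) * P * M * e N t"
        using False by (simp add: e_def q_def algebra_simps)
      finally show ?thesis .
    qed
  qed
  then have "(LINT t|lebesgue. \<bar>h t\<bar>) \<le> (LINT t|lebesgue. K * M * e x t + (K + 2) * P * M * e N t)"
    using int_h e[of x] e[of N] \<open>x \<le> N\<close>
    by (intro integral_mono_AE) (auto simp: has_bochner_integral_iff)
  also have "\<dots> = K * M * (exp (- (\<kappa> * x)) * (1 / \<kappa> + 1 / \<kappa>\<^sup>2)) +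
    (K + 2) * P * M * (exp (- (\<kappa> * N)) * ((1 + N - x) / \<kappa> + 1 / \<kappa>\<^sup>2))"
    using e[of x] e[of N] \<open>x \<le> N\<close> by (simp add: has_bochner_integral_iff)
  finally show ?thesis
    unfolding eq using integral_abs_bound[of lebesgue h] by linarith
qed

text \<open>With the rate \<open>\<kappa> = 4 K\<close> the factor \<open>K (1 / \<kappa> + 1 / \<kappa>\<^sup>2)\<close> is at most \<open>1 / 2\<close>.\<close>

lemma decay_improves:
  fixes W V u :: "real \<Rightarrow> real"
  assumes "Linfty W" "Linfty V" and u: "continuous_on UNIV u" and "weak_solution W V u"
    and W: "AE t in lebesgue. \<bar>W t\<bar> \<le> K" and V: "AE t in lebesgue. \<bar>V t\<bar> \<le> K" and "K \<ge> 1"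
    and decay: "\<And>t. \<bar>u t\<bar> \<le> M * exp (- (4 * K * t))"
  shows "\<bar>u x\<bar> \<le> M / 2 * exp (- (4 * K * x))"
proof (rule field_le_epsilon)
  \<comment> \<open>The slack \<eta> pays for replacing \<open>u x\<close> by an average of
    \<open>u\<close> just to the right of \<open>x\<close>.\<close>
  fix \<eta> :: real assume "\<eta> > 0"
  have "isCont u x"
    using u by (simp add: continuous_on_eq_continuous_at)
  then obtain \<delta>0 where "\<delta>0 > 0" and \<delta>0: "\<And>t. \<bar>t - x\<bar> < \<delta>0 \<Longrightarrow> \<bar>u t - u x\<bar> < \<eta>"
    using \<open>\<eta> > 0\<close> unfolding continuous_at_eps_delta dist_real_def by blast
  \<comment> \<open>Halving keeps the closed interval \<open>{x..x + \<delta>}\<close> inside the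
    open range supplied by continuity.\<close>
  define \<delta> where "\<delta> = \<delta>0 / 2"
  have "\<delta> > 0" "\<delta> < \<delta>0"
    using \<open>\<delta>0 > 0\<close> by (simp_all add: \<delta>_def)
  obtain \<sigma> \<theta> r :: "real \<Rightarrow> real"
    where sm: "smooth \<sigma>" "smooth \<theta>" "smooth r"
    and der: "\<And>t. (\<theta> has_field_derivative \<sigma> t) (at t)" "\<And>t. (r has_field_derivative \<theta> t) (at t)"
    and \<sigma>: "\<And>t. 0 \<le> \<sigma> t" "\<And>t. t \<notin> {x..x + \<delta>} \<Longrightarrow> \<sigma> t = 0"
    and \<theta>: "\<And>t. t \<le> x \<Longrightarrow> \<theta> t = 0" "\<And>t. x + \<delta> \<le> t \<Longrightarrow> \<theta> t = 1" "\<And>t. 0 \<le> \<theta> t" "\<And>t. \<theta> t \<le> 1"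
    and r: "\<And>t. 0 \<le> r t" "\<And>t. r t \<le> max 0 (t - x)"
    using scaled_step_exists[OF \<open>\<delta> > 0\<close>, of x] by blast
  have total: "(LINT t|lebesgue. \<sigma> t) = 1"
    using integral_step_derivative[OF der(1) smooth_continuous_on[OF sm(1)], of x "x + \<delta>"] \<sigma>(2) \<open>\<delta> > 0\<close> \<theta>(1,2)
    by simp
  have avg: "\<bar>(LINT t|lebesgue. u t * \<sigma> t) - u x\<bar> \<le> \<eta>"
  proof (rule average_close_to_value[OF u smooth_continuous_on[OF sm(1)] \<sigma> total])
    show "\<bar>u t - u x\<bar> \<le> \<eta>" if "t \<in> {x..x + \<delta>}" for t
      using \<delta>0[of t] that \<open>\<delta> < \<delta>0\<close> by auto
  qed
  \<comment> \<open>The cut-off will be a reflected translate of this one fixed step, so the bound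
    \<open>P\<close> on its derivatives does not depend on \<open>N\<close>.\<close>
  obtain \<rho> \<omega> s :: "real \<Rightarrow> real"
    where \<omega>_sm: "smooth \<rho>" "smooth \<omega>" "smooth s"
    and \<omega>_der: "\<And>t. (\<omega> has_field_derivative \<rho> t) (at t)" "\<And>t. (s has_field_derivative \<omega> t) (at t)"
    and \<rho>: "\<And>t. 0 \<le> \<rho> t" "\<And>t. t \<notin> {0..1} \<Longrightarrow> \<rho> t = 0"
    and \<omega>: "\<And>t. t \<le> 0 \<Longrightarrow> \<omega> t = 0" "\<And>t. 1 \<le> t \<Longrightarrow> \<omega> t = 1" "\<And>t. 0 \<le> \<omega> t" "\<And>t. \<omega> t \<le> 1"
    and s: "\<And>t. 0 \<le> s t" "\<And>t. s t \<le> max 0 t"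
    by (rule smooth_step_exists) blast
  obtain P1 where P1: "\<And>t. \<bar>\<rho> t\<bar> \<le> P1"
    using compact_support_bounded[OF smooth_continuous_on[OF \<omega>_sm(1)] \<rho>(2)] by blast
  obtain P2 where P2: "\<And>t. \<bar>deriv \<rho> t\<bar> \<le> P2"
    using compact_support_bounded[OF smooth_continuous_on[OF smooth_deriv[OF \<omega>_sm(1)]]
        deriv_zero_outside[of 0 1 \<rho>, OF \<rho>(2)]] by blast
  define P where "P = max P1 P2"
  let ?\<kappa> = "4 * K"
  let ?bound = "\<lambda>N. K * M * (exp (- (?\<kappa> * x)) * (1 / ?\<kappa> + 1 / ?\<kappa>\<^sup>2)) +
    (K + 2) * P * M * (exp (- (?\<kappa> * N)) * ((1 + N - x) / ?\<kappa> + 1 / ?\<kappa>\<^sup>2))"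
  have bound: "\<bar>LINT t|lebesgue. u t * \<sigma> t\<bar> \<le> ?bound N" if "N \<ge> x + \<delta>" for N
  proof -
    \<comment> \<open>Reflection turns the rising step into one that falls from 1 to 0 on
      \<open>{N..N + 1}\<close>.\<close>
    define \<psi> where "\<psi> t = \<omega> (N + 1 - t)" for t
    have "smooth \<psi>"
      using smooth_affine[OF \<omega>_sm(2), of 1 "-1" "N + 1"] by (simp add: \<psi>_def[abs_def])
    have refl_der: "((\<lambda>t. N + 1 - t) has_field_derivative - 1) (at t)" for t
      by (auto intro!: derivative_eq_intros)
    have \<psi>1: "deriv \<psi> = (\<lambda>t. - \<rho> (N + 1 - t))"
    proof (intro ext DERIV_imp_deriv)
      show "(\<psi> has_field_derivative - \<rho> (N + 1 - t)) (at t)" for t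
        using DERIV_chain2[OF \<omega>_der(1) refl_der, of t] by (simp add: \<psi>_def[abs_def])
    qed
    have \<psi>2: "deriv (deriv \<psi>) = (\<lambda>t. deriv \<rho> (N + 1 - t))"
      unfolding \<psi>1
    proof (intro ext DERIV_imp_deriv)
      show "((\<lambda>t. - \<rho> (N + 1 - t)) has_field_derivative deriv \<rho> (N + 1 - t)) (at t)" for t
        using DERIV_minus[OF DERIV_chain2[OF smooth_has_deriv[OF \<omega>_sm(1)] refl_der, of t]] by simp
    qed
    show ?thesis
    proof (rule ramp_test_estimate[where \<psi> = \<psi> and y = "x + \<delta>" and \<theta> = \<theta> and r = r,
          OF assms(1,2) u assms(4) W V _ decay sm der \<sigma>(2) \<theta>(1,3,4) r \<open>smooth \<psi>\<close>])
      show "\<bar>deriv \<psi> t\<bar> \<le> P" "\<bar>deriv (deriv \<psi>) t\<bar> \<le> P" for t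
        using P1[of "N + 1 - t"] P2[of "N + 1 - t"] unfolding \<psi>2 P_def
        by (simp_all add: \<psi>1 le_max_iff_disj)
    qed (use \<open>K \<ge> 1\<close> \<open>\<delta> > 0\<close> that \<omega> in \<open>auto simp: \<psi>_def\<close>)
  qed
  \<comment> \<open>Letting \<open>N\<close> tend to infinity removes the cut-off error: the
    exponential beats the linear factor while \<open>P\<close> stays fixed.\<close>
  have "(?bound \<longlongrightarrow> K * M * (exp (- (?\<kappa> * x)) * (1 / ?\<kappa> + 1 / ?\<kappa>\<^sup>2)) + (K + 2) * P * M * 0) at_top"
  proof (intro tendsto_add tendsto_mult tendsto_const)
    show "((\<lambda>N. exp (- (?\<kappa> * N)) * ((1 + N - x) / ?\<kappa> + 1 / ?\<kappa>\<^sup>2)) \<longlongrightarrow> 0) at_top"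
      using \<open>K \<ge> 1\<close> by real_asymp
  qed
  then have "\<bar>LINT t|lebesgue. u t * \<sigma> t\<bar> \<le> K * M * (exp (- (?\<kappa> * x)) * (1 / ?\<kappa> + 1 / ?\<kappa>\<^sup>2)) + (K + 2) * P * M * 0"
  proof (rule tendsto_lowerbound)
    show "\<forall>\<^sub>F N in at_top. \<bar>LINT t|lebesgue. u t * \<sigma> t\<bar> \<le> ?bound N"
      using eventually_ge_at_top[of "x + \<delta>"] by (rule eventually_mono) (rule bound)
  qed simp
  also have "\<dots> = (M * exp (- (?\<kappa> * x))) * (1 / 4 + 1 / (16 * K))"
    using \<open>K \<ge> 1\<close> by (simp add: field_simps power2_eq_square)
  also have "\<dots> \<le> (M * exp (- (?\<kappa> * x))) * (1 / 2)"
  proof (rule mult_left_mono)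
    show "1 / 4 + 1 / (16 * K) \<le> 1 / 2"
      using \<open>K \<ge> 1\<close> by (simp add: field_simps)
    show "0 \<le> M * exp (- (?\<kappa> * x))"
      using decay[of x] by linarith
  qed
  also have "\<dots> = M / 2 * exp (- (?\<kappa> * x))"
    by simp
  finally show "\<bar>u x\<bar> \<le> M / 2 * exp (- (?\<kappa> * x)) + \<eta>"
    using avg by linarith
qed

section \<open>From superexponential decay to vanishing\<close>

text \<open>Once \<open>\<bar>t\<bar>\<close> exceeds \<open>\<kappa> powr (1 / \<epsilon>)\<close>,
  the factor \<open>\<bar>t\<bar> powr \<epsilon>\<close> is at least \<kappa>; on the remaining
  bounded range the additive constant suffices. Hence the assumed decay implies exponential decay at
  any rate.\<close>

lemma superlinear_exponent:
  fixes \<kappa> \<epsilon> t :: real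
  assumes "\<kappa> > 0" "\<epsilon> > 0"
  shows "\<kappa> * \<bar>t\<bar> \<le> \<bar>t\<bar> powr (1 + \<epsilon>) + \<kappa> * \<kappa> powr (1 / \<epsilon>)"
proof (cases "\<bar>t\<bar> \<le> \<kappa> powr (1 / \<epsilon>)")
  case True
  then show ?thesis
    using assms by (simp add: add_increasing)
next
  case False
  then have "(\<kappa> powr (1 / \<epsilon>)) powr \<epsilon> \<le> \<bar>t\<bar> powr \<epsilon>"
    using assms by (intro powr_mono2) auto
  then have "\<kappa> * \<bar>t\<bar> \<le> \<bar>t\<bar> powr \<epsilon> * \<bar>t\<bar>"
    using assms by (intro mult_right_mono) (auto simp: powr_powr)
  then have "\<kappa> * \<bar>t\<bar> \<le> \<bar>t\<bar> powr (1 + \<epsilon>)"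
    by (simp add: powr_add mult.commute)
  then show ?thesis
    using assms by (simp add: add_increasing2)
qed

theorem theorem1p2:
  fixes W V u :: "real \<Rightarrow> real"
  assumes "Linfty W" and "Linfty V"
    and "continuous_on UNIV u"
    and "weak_solution W V u"
    and "\<exists>C>0. \<exists>\<epsilon>>0. \<forall>x. \<bar>u x\<bar> \<le> C * exp (- (\<bar>x\<bar> powr (1 + \<epsilon>)))"
  shows "\<forall>x. u x = 0"
proof -
  obtain K1 K2 where K12: "AE t in lebesgue. \<bar>W t\<bar> \<le> K1" "AE t in lebesgue. \<bar>V t\<bar> \<le> K2"
    using assms(1,2) by (auto simp: Linfty_def)
  \<comment> \<open>The lower bound 1 secures the hypothesis \<open>K \<ge> 1\<close> of
    \<open>decay_improves\<close> even when \<open>W\<close> and \<open>V\<close> are small.\<close>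
  define K where "K = max 1 (max K1 K2)"
  have K: "K \<ge> 1" "AE t in lebesgue. \<bar>W t\<bar> \<le> K" "AE t in lebesgue. \<bar>V t\<bar> \<le> K"
    using K12 by (auto simp: K_def elim: AE_mp)
  obtain C \<epsilon> where "C > 0" "\<epsilon> > 0" and C: "\<And>x. \<bar>u x\<bar> \<le> C * exp (- (\<bar>x\<bar> powr (1 + \<epsilon>)))"
    using assms(5) by blast
  \<comment> \<open>The additive constant of \<open>superlinear_exponent\<close> at rate 4K turns
    into a factor after exponentiation.\<close>
  define M where "M = C * exp (4 * K * (4 * K) powr (1 / \<epsilon>))"
  \<comment> \<open>The rate stays fixed while the constant halves. The point \<open>t\<close> is
    arbitrary in the induction because improving the bound at one point uses it at all
    points.\<close>
  have decay: "\<bar>u t\<bar> \<le> M / 2 ^ n * exp (- (4 * K * t))" for n t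
  proof (induction n arbitrary: t)
    case 0
    have "4 * K * t \<le> 4 * K * \<bar>t\<bar>"
      using \<open>K \<ge> 1\<close> by (intro mult_left_mono) auto
    then have "- (\<bar>t\<bar> powr (1 + \<epsilon>)) \<le> 4 * K * (4 * K) powr (1 / \<epsilon>) + - (4 * K * t)"
      using superlinear_exponent[of "4 * K" \<epsilon> t] \<open>K \<ge> 1\<close> \<open>\<epsilon> > 0\<close> by linarith
    then have "C * exp (- (\<bar>t\<bar> powr (1 + \<epsilon>))) \<le> C * exp (4 * K * (4 * K) powr (1 / \<epsilon>) + - (4 * K * t))"
      using \<open>C > 0\<close> by simp
    also have "\<dots> = M * exp (- (4 * K * t))"
      unfolding exp_add M_def by simp
    finally show ?case
      using C[of t] by simp
  next
    case (Suc n)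
    show ?case
      using decay_improves[OF assms(1-4) K(2,3,1) Suc.IH, of t] by (simp add: field_simps)
  qed
  have "u x = 0" for x
  proof -
    have "(\<lambda>n. M / 2 ^ n * exp (- (4 * K * x))) \<longlonglongrightarrow> 0"
      by real_asymp
    then have "\<bar>u x\<bar> \<le> 0"
      by (rule tendsto_lowerbound) (use decay in auto)
    then show ?thesis
      by simp
  qed
  then show ?thesis ..
qed

end
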